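(* Let $\{\mathcal F,\mathcal G\}$ be a minimal Hilbert C*-system with $\mathcal G$ nonabelian and such that the fixed point algebra $\mathcal A$, with center $\mathcal Z$, satisfies Property B. For any irreducible canonical endomorphism $\rho$ of $\mathcal A$ we have $\rho(\mathcal Z)=\mathcal Z$, and $\rho|_{\mathcal Z}$ is an automorphism of $\mathcal Z$.
   Context: C*-algebras are unital. An algebraic Hilbert space in $\mathcal F$ is a finite-dimensional subspace $\mathcal H\subset\mathcal F$ with $A^*B\in\mathbb C\mathbf 1$ for $A,B\in\mathcal H$, scalar product $\langle A,B\rangle\mathbf 1=A^*B$, always assumed to have support $\sum_j\Phi_j\Phi_j^*=\mathbf 1$ ($\{\Phi_j\}$ an orthonormal basis). For a compact group $\mathcal G$ acting on $\mathcal F$ by a pointwise norm-continuous homomorphism $\alpha:\mathcal G\to\mathrm{Aut}\,\mathcal F$ and $D\in\widehat{\mathcal G}$ (classes of irreducible unitary representations) put $\Pi_D(F)=\int_{\mathcal G}\overline{\chi_D(g)}\,\alpha_g(F)\,dg$, $\chi_D(g)=\dim D\cdot\mathrm{Tr}\,\pi(g)$, $\pi\in D$. The system is a Hilbert C*-system if for each $D$ there is an $\alpha_{\mathcal G}$-invariant algebraic Hilbert space $\mathcal H_D\subset\Pi_D\mathcal F$ carrying a representation of class $D$. One identifies $\mathcal G$ with $\alpha_{\mathcal G}$ and writes $\{\mathcal F,\mathcal G\}$; $\mathcal A$ is the fixed point algebra and $\mathcal Z=\mathcal A'\cap\mathcal A$. Minimal: $\mathcal A'\cap\mathcal F=\mathcal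 Z$. Property B: $\mathcal A$ contains isometries $V,W$ with $VV^*+WW^*=\mathbf 1$. Canonical endomorphisms: $\rho_{\mathcal H}(A)=\sum_j\Phi_jA\Phi_j^*$, $A\in\mathcal A$, for $\mathcal G$-invariant algebraic Hilbert spaces $\mathcal H\subset\mathcal F$. With $(\rho,\rho)=\{X\in\mathcal A:X\rho(A)=\rho(A)X\ \forall A\in\mathcal A\}$, a canonical endomorphism $\rho=\rho_{\mathcal H}$ is irreducible if $(\rho,\rho)=\rho(\mathcal Z)$; this corresponds to $\mathcal G$ acting irreducibly on $\mathcal H$. *)

theory Defs
  imports "HOL-Analysis.Analysis" "Jordan_Normal_Form.Schur_Decomposition"
begin

section \<open>Unital C*-algebras\<close>

class scaleC =
  fixes scaleC :: "complex \<Rightarrow> 'a \<Rightarrow> 'a" (infixr \<open>*\<^sub>C\<close> 75)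

class unital_cstar_algebra = real_normed_algebra_1 + banach + scaleC +
  fixes adj :: "'a \<Rightarrow> 'a"
  assumes scaleC_add_right: "c *\<^sub>C (x + y) = c *\<^sub>C x + c *\<^sub>C y"
    and scaleC_add_left: "(c + d) *\<^sub>C x = c *\<^sub>C x + d *\<^sub>C x"
    and scaleC_scaleC: "c *\<^sub>C d *\<^sub>C x = (c * d) *\<^sub>C x"
    and scaleR_scaleC: "scaleR r x = complex_of_real r *\<^sub>C x"
    and mult_scaleC_left: "(c *\<^sub>C x) * y = c *\<^sub>C (x * y)"
    and mult_scaleC_right: "x * (c *\<^sub>C y) = c *\<^sub>C (x * y)"
    and norm_scaleC: "norm (c *\<^sub>C x) = cmod c * norm x"
    and adj_adj: "adj (adj x) = x"
    and adj_add: "adj (x + y) = adj x + adj y"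
    and adj_scaleC: "adj (c *\<^sub>C x) = cnj c *\<^sub>C adj x"
    and adj_mult: "adj (x * y) = adj y * adj x"
    and norm_adj_mult_self: "norm (adj x * x) = (norm x)\<^sup>2"

global_interpretation cvec: vector_space
  "scaleC :: complex \<Rightarrow> 'a \<Rightarrow> 'a::unital_cstar_algebra"
proof
  fix x :: 'a
  show "1 *\<^sub>C x = x"
    using scaleR_scaleC[of 1 x] by simp
qed (simp_all add: scaleC_add_right scaleC_add_left scaleC_scaleC)

definition star_automorphism_on ::
  "'f::unital_cstar_algebra set \<Rightarrow> ('f \<Rightarrow> 'f) \<Rightarrow> bool" where
  "star_automorphism_on S f \<longleftrightarrow>
     bij_betw f S S \<and>
     (\<forall>x\<in>S. \<forall>y\<in>S. f (x + y) = f x + f y) \<and>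
     (\<forall>c. \<forall>x\<in>S. f (c *\<^sub>C x) = c *\<^sub>C f x) \<and>
     (\<forall>x\<in>S. \<forall>y\<in>S. f (x * y) = f x * f y) \<and>
     (\<forall>x\<in>S. f (adj x) = adj (f x))"

definition commutant :: "'f::unital_cstar_algebra set \<Rightarrow> 'f set" where
  "commutant S = {F. \<forall>A\<in>S. A * F = F * A}"

section \<open>Algebraic Hilbert spaces\<close>

definition orthonormal_basis :: "'f::unital_cstar_algebra set \<Rightarrow> 'f set \<Rightarrow> bool" where
  "orthonormal_basis B H \<longleftrightarrow>
     finite B \<and> cvec.span B = H \<and>
     (\<forall>\<Phi>\<in>B. \<forall>\<Psi>\<in>B. adj \<Phi> * \<Psi> = (if \<Phi> = \<Psi> then 1 else 0))"

(* The support does not depend on the orthonormal basis, and one always exists. *)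
definition algebraic_hilbert_space :: "'f::unital_cstar_algebra set \<Rightarrow> bool" where
  "algebraic_hilbert_space H \<longleftrightarrow>
     cvec.subspace H \<and> (\<exists>S. finite S \<and> cvec.span S = H) \<and>
     (\<forall>A\<in>H. \<forall>B\<in>H. \<exists>c. adj A * B = c *\<^sub>C 1) \<and>
     (\<exists>B. orthonormal_basis B H \<and> (\<Sum>\<Phi>\<in>B. \<Phi> * adj \<Phi>) = 1)"

section \<open>Compact group actions\<close>

text \<open>
  The group is a type of class \<^class>\<open>topological_group_add\<close>. Despite the additive notation this
  class does not assume commutativity.
\<close>

definition cstar_action ::
  "('g::topological_group_add \<Rightarrow> 'f::unital_cstar_algebra \<Rightarrow> 'f) \<Rightarrow> bool" where
  "cstar_action \<alpha> \<longleftrightarrow>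
     (\<forall>g. star_automorphism_on UNIV (\<alpha> g)) \<and>
     (\<forall>g h. \<alpha> (g + h) = \<alpha> g \<circ> \<alpha> h) \<and>
     (\<forall>F. continuous_on UNIV (\<lambda>g. \<alpha> g F))"

definition invariant_subset :: "('g \<Rightarrow> 'f \<Rightarrow> 'f) \<Rightarrow> 'f set \<Rightarrow> bool" where
  "invariant_subset \<alpha> H \<longleftrightarrow> (\<forall>g. \<alpha> g ` H \<subseteq> H)"

definition fixed_points :: "('g \<Rightarrow> 'f \<Rightarrow> 'f) \<Rightarrow> 'f set" where
  "fixed_points \<alpha> = {F. \<forall>g. \<alpha> g F = F}"

definition fixed_center :: "('g \<Rightarrow> 'f::unital_cstar_algebra \<Rightarrow> 'f) \<Rightarrow> 'f set" where
  "fixed_center \<alpha> = commutant (fixed_points \<alpha>) \<inter> fixed_points \<alpha>"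

section \<open>Normalized Haar measure and spectral projections\<close>

(* For finite Borel measures on a compact Hausdorff space, outer regularity on all Borel
   sets already implies inner regularity by compact sets. *)
definition is_haar_measure :: "'g::topological_group_add measure \<Rightarrow> bool" where
  "is_haar_measure \<mu> \<longleftrightarrow>
     sets \<mu> = sets borel \<and> emeasure \<mu> UNIV = 1 \<and>
     (\<forall>g. distr \<mu> borel (\<lambda>h. g + h) = \<mu>) \<and>
     (\<forall>A\<in>sets borel. emeasure \<mu> A = (INF U\<in>{U. A \<subseteq> U \<and> open U}. emeasure \<mu> U))"

(* Exists and is unique for compact Hausdorff groups, the only case in which it is used. *)
definition haar_measure :: "'g::topological_group_add measure" where
  "haar_measure = (THE \<mu>. is_haar_measure \<mu>)"

(* The library's Bochner integral needs a second countable codomain, which would exclude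
   nonseparable algebras. For continuous functions on a compact space the weak (Pettis)
   integral exists and agrees with the Bochner integral; it is unique by Hahn-Banach. *)
definition weak_integral :: "'g measure \<Rightarrow> ('g \<Rightarrow> 'f::real_normed_vector) \<Rightarrow> 'f" where
  "weak_integral \<mu> f =
     (THE v. \<forall>\<phi> :: 'f \<Rightarrow> real. bounded_linear \<phi> \<longrightarrow>
        has_bochner_integral \<mu> (\<lambda>g. \<phi> (f g)) (\<phi> v))"

(* Irreducible unitary representations of a compact group are finite-dimensional, so each
   class contains continuous homomorphisms into the unitary n x n matrices. *)
definition unitary_rep :: "nat \<Rightarrow> ('g::topological_group_add \<Rightarrow> complex mat) \<Rightarrow> bool" where
  "unitary_rep n \<pi> \<longleftrightarrow>
     (\<forall>g. \<pi> g \<in> carrier_mat n n \<and>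
          \<pi> g * mat_adjoint (\<pi> g) = 1\<^sub>m n \<and> mat_adjoint (\<pi> g) * \<pi> g = 1\<^sub>m n) \<and>
     (\<forall>g h. \<pi> (g + h) = \<pi> g * \<pi> h) \<and>
     (\<forall>i<n. \<forall>j<n. continuous_on UNIV (\<lambda>g. \<pi> g $$ (i, j)))"

definition irreducible_unitary_rep ::
  "nat \<Rightarrow> ('g::topological_group_add \<Rightarrow> complex mat) \<Rightarrow> bool" where
  "irreducible_unitary_rep n \<pi> \<longleftrightarrow>
     n > 0 \<and> unitary_rep n \<pi> \<and>
     (\<forall>W \<subseteq> carrier_vec n.
        0\<^sub>v n \<in> W \<and> (\<forall>v\<in>W. \<forall>w\<in>W. v + w \<in> W) \<and> (\<forall>c. \<forall>v\<in>W. c \<cdot>\<^sub>v v \<in> W) \<and>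
        (\<forall>g. \<forall>v\<in>W. \<pi> g *\<^sub>v v \<in> W) \<longrightarrow>
        W = {0\<^sub>v n} \<or> W = carrier_vec n)"

(* The character is normalized by an extra factor dim D, so that spectral_projection below
   is idempotent. *)
definition normalized_character :: "nat \<Rightarrow> ('g \<Rightarrow> complex mat) \<Rightarrow> 'g \<Rightarrow> complex" where
  "normalized_character n \<pi> g = of_nat n * (\<Sum>i<n. \<pi> g $$ (i, i))"

definition spectral_projection ::
  "('g::topological_group_add \<Rightarrow> 'f::unital_cstar_algebra \<Rightarrow> 'f) \<Rightarrow>
    nat \<Rightarrow> ('g \<Rightarrow> complex mat) \<Rightarrow> 'f \<Rightarrow> 'f" where
  "spectral_projection \<alpha> n \<pi> F =
     weak_integral haar_measure (\<lambda>g. cnj (normalized_character n \<pi> g) *\<^sub>C \<alpha> g F)"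

(* V is a unitary intertwiner from C^n onto H. The product v \<bullet>c w is linear in v and
   conjugate-linear in w, whereas A* B is conjugate-linear in A. *)
definition carries_class ::
  "('g \<Rightarrow> 'f::unital_cstar_algebra \<Rightarrow> 'f) \<Rightarrow> 'f set \<Rightarrow> nat \<Rightarrow> ('g \<Rightarrow> complex mat) \<Rightarrow> bool" where
  "carries_class \<alpha> H n \<pi> \<longleftrightarrow>
     (\<exists>V. bij_betw V (carrier_vec n) H \<and>
        (\<forall>v\<in>carrier_vec n. \<forall>w\<in>carrier_vec n. V (v + w) = V v + V w) \<and>
        (\<forall>c. \<forall>v\<in>carrier_vec n. V (c \<cdot>\<^sub>v v) = c *\<^sub>C V v) \<and>
        (\<forall>v\<in>carrier_vec n. \<forall>w\<in>carrier_vec n. adj (V v) * V w = (w \<bullet>c v) *\<^sub>C 1) \<and>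
        (\<forall>g. \<forall>v\<in>carrier_vec n. \<alpha> g (V v) = V (\<pi> g *\<^sub>v v)))"

section \<open>Hilbert C*-systems\<close>

definition hilbert_cstar_system ::
  "('g::{topological_group_add, t2_space} \<Rightarrow> 'f::unital_cstar_algebra \<Rightarrow> 'f) \<Rightarrow> bool" where
  "hilbert_cstar_system \<alpha> \<longleftrightarrow>
     compact (UNIV :: 'g set) \<and> cstar_action \<alpha> \<and>
     (\<forall>n \<pi>. irreducible_unitary_rep n \<pi> \<longrightarrow>
        (\<exists>H. algebraic_hilbert_space H \<and> invariant_subset \<alpha> H \<and>
             H \<subseteq> range (spectral_projection \<alpha> n \<pi>) \<and> carries_class \<alpha> H n \<pi>))"

definition minimal_system :: "('g \<Rightarrow> 'f::unital_cstar_algebra \<Rightarrow> 'f) \<Rightarrow> bool" where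
  "minimal_system \<alpha> \<longleftrightarrow> commutant (fixed_points \<alpha>) = fixed_center \<alpha>"

definition property_B :: "'f::unital_cstar_algebra set \<Rightarrow> bool" where
  "property_B S \<longleftrightarrow>
     (\<exists>V\<in>S. \<exists>W\<in>S. adj V * V = 1 \<and> adj W * W = 1 \<and> V * adj V + W * adj W = 1)"

(* The sum is independent of the orthonormal basis. An endomorphism of the fixed point
   algebra is a function on the whole type whose values outside that algebra are irrelevant. *)
definition canonical_endomorphism ::
  "('g \<Rightarrow> 'f::unital_cstar_algebra \<Rightarrow> 'f) \<Rightarrow> ('f \<Rightarrow> 'f) \<Rightarrow> bool" where
  "canonical_endomorphism \<alpha> \<rho> \<longleftrightarrow>
     (\<exists>H B. algebraic_hilbert_space H \<and> invariant_subset \<alpha> H \<and> orthonormal_basis B H \<and>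
        (\<forall>A\<in>fixed_points \<alpha>. \<rho> A = (\<Sum>\<Phi>\<in>B. \<Phi> * A * adj \<Phi>)))"

definition self_intertwiners ::
  "('g \<Rightarrow> 'f::unital_cstar_algebra \<Rightarrow> 'f) \<Rightarrow> ('f \<Rightarrow> 'f) \<Rightarrow> 'f set" where
  "self_intertwiners \<alpha> \<rho> =
     {X \<in> fixed_points \<alpha>. \<forall>A\<in>fixed_points \<alpha>. X * \<rho> A = \<rho> A * X}"

definition irreducible_endomorphism ::
  "('g \<Rightarrow> 'f::unital_cstar_algebra \<Rightarrow> 'f) \<Rightarrow> ('f \<Rightarrow> 'f) \<Rightarrow> bool" where
  "irreducible_endomorphism \<alpha> \<rho> \<longleftrightarrow> self_intertwiners \<alpha> \<rho> = \<rho> ` fixed_center \<alpha>"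

end

(*
  The center Z commutes with the image of rho, so irreducibility gives Z <= (rho, rho) = rho(Z).
  Conversely, let Phi_k be an orthonormal basis of the space H of rho. The projection onto an
  invariant subspace of H lies in (rho, rho), so G acts irreducibly on H, and therefore also by
  the conjugate representation, for which the system has an algebraic Hilbert space with basis
  Psi_k. For z in Z the matrix of z in the basis Psi_k has entries in Z by minimality and commutes
  with the representation, so z Psi_k = Psi_k c for some c in Z. The invariant element
  R = sum_k Psi_k Phi_k commutes with z and Phi_k = Psi_k* R, so (taking adjoints) this turns into
  Phi_k z = c' Phi_k with c' in Z, that is, rho(z) = c'.
*)

theory Submission
  imports Defs
begin

section \<open>Elementary rules for adjoints and scalars\<close>

lemma adj_zero [simp]: "adj (0::'f::unital_cstar_algebra) = 0"
  using adj_add[of "0::'f" 0] by simp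

lemma adj_one [simp]: "adj (1::'f::unital_cstar_algebra) = 1"
  by (metis adj_adj adj_mult mult.right_neutral mult.left_neutral)

lemma adj_sum: "adj (\<Sum>i\<in>I. f i) = (\<Sum>i\<in>I. adj (f i :: 'f::unital_cstar_algebra))"
  by (induction I rule: infinite_finite_induct) (auto simp: adj_add)

lemma scaleC_one_eq_iff [simp]: "c *\<^sub>C (1::'f::unital_cstar_algebra) = d *\<^sub>C 1 \<longleftrightarrow> c = d"
  by (simp add: cvec.scale_right_imp_eq)

lemma adj_mult_self_eq_zero [simp]: "adj x * x = 0 \<longleftrightarrow> x = (0 :: 'f::unital_cstar_algebra)"
  using norm_adj_mult_self[of x] by auto

text \<open>Meaningful only on multiples of \<open>1\<close>.\<close>

definition scalar_of :: "'f::unital_cstar_algebra \<Rightarrow> complex" where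
  "scalar_of x = (THE c. x = c *\<^sub>C 1)"

lemma scalar_of_scaleC_one [simp]: "scalar_of (c *\<^sub>C 1) = c"
  unfolding scalar_of_def by (rule the_equality) auto

section \<open>Orthonormal bases of algebraic Hilbert spaces\<close>

lemma orthonormal_basis_subset:
  assumes "orthonormal_basis B H" shows "B \<subseteq> H"
  using assms cvec.span_superset unfolding orthonormal_basis_def by blast

text \<open>The elements fixed by the support form a subspace, and orthonormality puts
  \<open>B\<close> into it. No value of the support is prescribed, so that the rule also serves
  proper subspaces of an algebraic Hilbert space.\<close>

lemma orthonormal_basis_support_mult:
  fixes H :: "'f::unital_cstar_algebra set"
  assumes B: "orthonormal_basis B H" and x: "x \<in> H"
  shows "(\<Sum>\<Phi>\<in>B. \<Phi> * adj \<Phi>) * x = x"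
proof -
  let ?P = "\<Sum>\<Phi>\<in>B. \<Phi> * adj \<Phi>"
  have fin: "finite B" and o: "\<And>\<Phi> \<Psi>. \<Phi> \<in> B \<Longrightarrow> \<Psi> \<in> B \<Longrightarrow> adj \<Phi> * \<Psi> = (if \<Phi> = \<Psi> then 1 else 0)"
    using B unfolding orthonormal_basis_def by auto
  have sub: "cvec.subspace {y. ?P * y = y}"
    by (rule cvec.subspaceI) (auto simp: distrib_left mult_scaleC_right)
  have "B \<subseteq> {y. ?P * y = y}"
  proof (clarify)
    fix \<Psi> assume "\<Psi> \<in> B"
    then have "?P * \<Psi> = (\<Sum>\<Phi>\<in>B. if \<Phi> = \<Psi> then \<Phi> else 0)"
      by (auto simp: sum_distrib_right mult.assoc o intro!: sum.cong)
    then show "?P * \<Psi> = \<Psi>" using fin \<open>\<Psi> \<in> B\<close> by simp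
  qed
  then have "cvec.span B \<subseteq> {y. ?P * y = y}" using sub by (rule cvec.span_minimal)
  then show ?thesis using B x unfolding orthonormal_basis_def by blast
qed

text \<open>The property passes from \<open>B\<close> to its span in one argument at a time: first
  in \<open>y\<close> with a basis vector on the left, then in \<open>x\<close> with
  \<open>y\<close> kept fixed.\<close>

lemma orthonormal_basis_scalar_product:
  fixes H :: "'f::unital_cstar_algebra set"
  assumes B: "orthonormal_basis B H" and x: "x \<in> H" and y: "y \<in> H"
  shows "adj x * y = scalar_of (adj x * y) *\<^sub>C 1"
proof -
  have o: "\<And>\<Phi> \<Psi>. \<Phi> \<in> B \<Longrightarrow> \<Psi> \<in> B \<Longrightarrow> adj \<Phi> * \<Psi> = (if \<Phi> = \<Psi> then 1 else 0)"
    and sp: "cvec.span B = H"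
    using B unfolding orthonormal_basis_def by auto
  have sub: "cvec.subspace {y::'f. \<exists>c. adj b * y = c *\<^sub>C 1}" for b
    by (rule cvec.subspaceI)
      (auto simp: distrib_left mult_scaleC_right scaleC_scaleC simp flip: scaleC_add_left
        intro: exI[of _ 0])
  have 1: "\<exists>c. adj b * y = c *\<^sub>C 1" if "b \<in> B" "y \<in> H" for b y
  proof -
    have "B \<subseteq> {y::'f. \<exists>c. adj b * y = c *\<^sub>C 1}"
    proof
      fix y assume "y \<in> B"
      then have "adj b * y = (if b = y then 1 else 0) *\<^sub>C 1" using o that by simp
      then show "y \<in> {y. \<exists>c. adj b * y = c *\<^sub>C 1}" by blast
    qed
    from cvec.span_minimal[OF this sub] show ?thesis using that sp by auto
  qed
  have sub': "cvec.subspace {x::'f. \<exists>c. adj x * y = c *\<^sub>C 1}"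
    by (rule cvec.subspaceI)
      (auto simp: distrib_right adj_add adj_scaleC mult_scaleC_left scaleC_scaleC simp flip: scaleC_add_left
        intro: exI[of _ 0])
  have "B \<subseteq> {x::'f. \<exists>c. adj x * y = c *\<^sub>C 1}" using 1 y by auto
  from cvec.span_minimal[OF this sub'] obtain c where "adj x * y = c *\<^sub>C 1" using sp x by auto
  then show ?thesis by simp
qed

lemma orthonormal_basis_expansion:
  fixes H :: "'f::unital_cstar_algebra set"
  assumes B: "orthonormal_basis B H" and x: "x \<in> H"
  shows "x = (\<Sum>\<Phi>\<in>B. scalar_of (adj \<Phi> * x) *\<^sub>C \<Phi>)"
proof -
  have "x = (\<Sum>\<Phi>\<in>B. \<Phi> * (adj \<Phi> * x))"
    using orthonormal_basis_support_mult[OF B x] by (simp add: sum_distrib_right mult.assoc)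
  also have "\<dots> = (\<Sum>\<Phi>\<in>B. scalar_of (adj \<Phi> * x) *\<^sub>C \<Phi>)"
  proof (rule sum.cong[OF refl])
    fix \<Phi> assume "\<Phi> \<in> B"
    then have "adj \<Phi> * x = scalar_of (adj \<Phi> * x) *\<^sub>C 1"
      using orthonormal_basis_scalar_product[OF B _ x] orthonormal_basis_subset[OF B] by blast
    then show "\<Phi> * (adj \<Phi> * x) = scalar_of (adj \<Phi> * x) *\<^sub>C \<Phi>"
      by (metis mult.right_neutral mult_scaleC_right)
  qed
  finally show ?thesis .
qed

text \<open>Parseval: \<open>r\<close> is the sum of the squared moduli of the coefficients of
  \<open>x\<close>, and \<open>adj x * x = 0\<close> would force \<open>x = 0\<close>. Positivity of
  \<open>r\<close> is what permits normalizing a vector below.\<close>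

lemma orthonormal_basis_positive:
  fixes H :: "'f::unital_cstar_algebra set"
  assumes B: "orthonormal_basis B H" and x: "x \<in> H" and "x \<noteq> 0"
  obtains r where "r > 0" "adj x * x = complex_of_real r *\<^sub>C 1"
proof -
  let ?c = "\<lambda>\<Phi>. scalar_of (adj \<Phi> * x)"
  let ?r = "\<Sum>\<Phi>\<in>B. (cmod (?c \<Phi>))\<^sup>2"
  have "adj x * x = adj x * ((\<Sum>\<Phi>\<in>B. \<Phi> * adj \<Phi>) * x)"
    using orthonormal_basis_support_mult[OF B x] by simp
  also have "\<dots> = (\<Sum>\<Phi>\<in>B. adj (adj \<Phi> * x) * (adj \<Phi> * x))"
    by (simp add: sum_distrib_left sum_distrib_right mult.assoc adj_mult adj_adj)
  also have "\<dots> = (\<Sum>\<Phi>\<in>B. complex_of_real ((cmod (?c \<Phi>))\<^sup>2) *\<^sub>C 1)"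
  proof (rule sum.cong[OF refl])
    fix \<Phi> assume "\<Phi> \<in> B"
    then have "adj \<Phi> * x = ?c \<Phi> *\<^sub>C 1"
      using orthonormal_basis_scalar_product[OF B _ x] orthonormal_basis_subset[OF B] by blast
    then have "adj (adj \<Phi> * x) * (adj \<Phi> * x) = (cnj (?c \<Phi>) * ?c \<Phi>) *\<^sub>C 1"
      by (metis adj_scaleC adj_one mult_scaleC_left mult_scaleC_right scaleC_scaleC mult.right_neutral mult.commute)
    then show "adj (adj \<Phi> * x) * (adj \<Phi> * x) = complex_of_real ((cmod (?c \<Phi>))\<^sup>2) *\<^sub>C 1"
      by (simp only: complex_norm_square mult.commute)
  qed
  also have "\<dots> = complex_of_real ?r *\<^sub>C 1"
    by (simp add: cvec.scale_sum_left)
  finally have eq: "adj x * x = complex_of_real ?r *\<^sub>C 1" .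
  have "?r \<noteq> 0"
  proof
    assume "?r = 0"
    with eq have "adj x * x = 0" by (simp only: of_real_0 cvec.scale_zero_left)
    with \<open>x \<noteq> 0\<close> show False by simp
  qed
  then have "?r > 0" by (simp add: order_less_le sum_nonneg)
  then show thesis using that eq by blast
qed

text \<open>Orthonormal sets are linearly independent, so those inside \<open>K\<close> have at most
  \<open>card B\<close> elements and one of maximal size exists. It spans \<open>K\<close>:
  subtracting from a vector of \<open>K\<close> its orthogonal projection and normalizing a nonzero
  remainder would give a larger orthonormal set.\<close>

lemma orthonormal_basis_subspace_exists:
  fixes H :: "'f::unital_cstar_algebra set"
  assumes B: "orthonormal_basis B H" and K: "cvec.subspace K" "K \<subseteq> H"
  obtains C where "orthonormal_basis C K"
proof -
  define ok where "ok C \<longleftrightarrow> C \<subseteq> K \<and> finite C \<and>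
     (\<forall>\<Phi>\<in>C. \<forall>\<Psi>\<in>C. adj \<Phi> * \<Psi> = (if \<Phi> = \<Psi> then 1 else 0))" for C :: "'f set"
  have bound: "card C \<le> card B" if "ok C" for C
  proof -
    have "cvec.independent C"
    proof (rule cvec.independent_if_scalars_zero)
      show "finite C" using that ok_def by auto
      fix f x assume s: "(\<Sum>x\<in>C. f x *\<^sub>C x) = 0" and x: "x \<in> C"
      have "0 = adj x * (\<Sum>x\<in>C. f x *\<^sub>C x)" using s by simp
      also have "\<dots> = (\<Sum>y\<in>C. if y = x then f x *\<^sub>C 1 else 0)"
        unfolding sum_distrib_left mult_scaleC_right
        by (rule sum.cong[OF refl]) (use that x in \<open>simp add: ok_def\<close>)
      also have "\<dots> = f x *\<^sub>C 1" using x \<open>finite C\<close> by simp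
      finally show "f x = 0" by simp
    qed
    moreover have "C \<subseteq> cvec.span B" "finite B"
      using B K that unfolding ok_def orthonormal_basis_def by auto
    ultimately show ?thesis using cvec.independent_span_bound by blast
  qed
  have "ok {}" by (simp add: ok_def)
  then obtain C where C: "ok C" and max: "\<And>C'. ok C' \<Longrightarrow> card C' \<le> card C"
    using bound ex_has_greatest_nat[of ok "{}" card "Suc (card B)"] by (auto simp: less_Suc_eq_le)
  have finC: "finite C" and CK: "C \<subseteq> K"
    and o: "\<And>\<Phi> \<Psi>. \<Phi> \<in> C \<Longrightarrow> \<Psi> \<in> C \<Longrightarrow> adj \<Phi> * \<Psi> = (if \<Phi> = \<Psi> then 1 else 0)"
    using C ok_def by auto
  have "K \<subseteq> cvec.span C"
  proof
    fix x assume x: "x \<in> K"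
    define p where "p = (\<Sum>\<Psi>\<in>C. \<Psi> * (adj \<Psi> * x))"
    have p: "p = (\<Sum>\<Psi>\<in>C. scalar_of (adj \<Psi> * x) *\<^sub>C \<Psi>)"
      unfolding p_def
    proof (rule sum.cong[OF refl])
      fix \<Psi> assume "\<Psi> \<in> C"
      then have "adj \<Psi> * x = scalar_of (adj \<Psi> * x) *\<^sub>C 1"
        using orthonormal_basis_scalar_product[OF B] CK K x by blast
      then show "\<Psi> * (adj \<Psi> * x) = scalar_of (adj \<Psi> * x) *\<^sub>C \<Psi>"
        by (metis mult.right_neutral mult_scaleC_right)
    qed
    have pC: "p \<in> cvec.span C" unfolding p
      by (intro cvec.span_sum cvec.span_scale cvec.span_base)
    have pK: "p \<in> K" using cvec.span_minimal[OF CK K(1)] pC by auto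
    have "x = p"
    proof (rule ccontr)
      assume ne: "x \<noteq> p"
      define y where "y = x - p"
      have yK: "y \<in> K" unfolding y_def using x pK K(1) by (rule cvec.subspace_diff[rotated])
      have "y \<noteq> 0" using ne y_def by simp
      then obtain r where r: "r > 0" "adj y * y = complex_of_real r *\<^sub>C 1"
        using orthonormal_basis_positive[OF B] yK K by blast
      have oy: "adj \<Psi> * y = 0" if "\<Psi> \<in> C" for \<Psi>
      proof -
        have "adj \<Psi> * p = (\<Sum>\<Phi>\<in>C. (adj \<Psi> * \<Phi>) * (adj \<Phi> * x))"
          by (simp add: p_def sum_distrib_left mult.assoc)
        also have "\<dots> = (\<Sum>\<Phi>\<in>C. if \<Phi> = \<Psi> then adj \<Psi> * x else 0)"
          using that by (auto simp: o intro!: sum.cong)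
        also have "\<dots> = adj \<Psi> * x" using finC that by simp
        finally show ?thesis by (simp add: y_def right_diff_distrib)
      qed
      define w where "w = complex_of_real (1 / sqrt r) *\<^sub>C y"
      have wK: "w \<in> K" unfolding w_def using K(1) yK by (rule cvec.subspace_scale)
      have ww: "adj w * w = 1"
        using r by (simp add: w_def adj_scaleC mult_scaleC_left mult_scaleC_right scaleC_scaleC
            flip: of_real_mult)
      have ow: "adj \<Psi> * w = 0" if "\<Psi> \<in> C" for \<Psi>
        using oy[OF that] by (simp add: w_def mult_scaleC_right)
      have wo: "adj w * \<Psi> = 0" if "\<Psi> \<in> C" for \<Psi>
        using arg_cong[OF ow[OF that], of adj] by (simp add: adj_mult adj_adj)
      have wC: "w \<notin> C" using ow ww by fastforce
      have "ok (insert w C)"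
        using wK CK finC o ww ow wo wC by (auto simp: ok_def)
      from max[OF this] show False using finC wC by simp
    qed
    then show "x \<in> cvec.span C" using pC by simp
  qed
  then have "cvec.span C = K" using cvec.span_minimal[OF CK K(1)] by auto
  then show thesis using that[of C] finC o by (simp add: orthonormal_basis_def)
qed

text \<open>Left multiplication by the support of \<open>B\<close> fixes \<open>H\<close>, hence
  fixes the support of the basis \<open>C\<close> supplied by the definition, and that support is
  1.\<close>

lemma orthonormal_basis_support:
  assumes H: "algebraic_hilbert_space H" and B: "orthonormal_basis B H"
  shows "(\<Sum>\<Phi>\<in>B. \<Phi> * adj \<Phi>) = 1"
proof -
  obtain C where C: "orthonormal_basis C H" "(\<Sum>\<Phi>\<in>C. \<Phi> * adj \<Phi>) = 1"
    using H unfolding algebraic_hilbert_space_def by blast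
  have "(\<Sum>\<Phi>\<in>B. \<Phi> * adj \<Phi>) * (\<Sum>\<Phi>\<in>C. \<Phi> * adj \<Phi>) = (\<Sum>\<Phi>\<in>C. \<Phi> * adj \<Phi>)"
    unfolding sum_distrib_left
    by (rule sum.cong[OF refl])
      (metis orthonormal_basis_support_mult[OF B] orthonormal_basis_subset[OF C(1)] subsetD mult.assoc)
  then show ?thesis using C by simp
qed

section \<open>Invariant algebraic Hilbert spaces\<close>

locale algebra_action =
  fixes \<alpha> :: "'g::topological_group_add \<Rightarrow> 'f::unital_cstar_algebra \<Rightarrow> 'f"
  assumes action: "cstar_action \<alpha>"
begin

lemma action_automorphism: "star_automorphism_on UNIV (\<alpha> g)"
  using action by (simp add: cstar_action_def)

lemma action_add: "\<alpha> g (x + y) = \<alpha> g x + \<alpha> g y"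
  and action_scaleC: "\<alpha> g (c *\<^sub>C x) = c *\<^sub>C \<alpha> g x"
  and action_mult: "\<alpha> g (x * y) = \<alpha> g x * \<alpha> g y"
  and action_adj: "\<alpha> g (adj x) = adj (\<alpha> g x)"
  and action_bij: "bij (\<alpha> g)"
  using action_automorphism[of g] by (auto simp: star_automorphism_on_def)

lemma action_zero: "\<alpha> g 0 = 0"
  using action_add[of g 0 0] by simp

lemma action_one: "\<alpha> g 1 = 1"
proof -
  obtain x where "\<alpha> g x = 1" using action_bij[of g] by (metis bij_pointE)
  then show ?thesis using action_mult[of g x 1] by simp
qed

lemma action_sum: "\<alpha> g (\<Sum>i\<in>I. f i) = (\<Sum>i\<in>I. \<alpha> g (f i))"
  by (induction I rule: infinite_finite_induct) (auto simp: action_zero action_add)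

lemma action_plus: "\<alpha> (g + h) x = \<alpha> g (\<alpha> h x)"
  using action by (simp add: cstar_action_def)

text \<open>\<open>\<alpha> 0\<close> is idempotent and injective, hence the identity.\<close>

lemma action_inverse: "\<alpha> g (\<alpha> (- g) x) = x"
proof -
  have "\<alpha> 0 (\<alpha> 0 x) = \<alpha> 0 x" by (simp flip: action_plus)
  then have "\<alpha> 0 x = x" using action_bij[of 0] by (metis bij_is_inj injD)
  then show ?thesis by (simp flip: action_plus)
qed

lemma action_continuous: "continuous_on UNIV (\<lambda>g. \<alpha> g x)"
  using action by (simp add: cstar_action_def)

lemma action_fixed: "x \<in> fixed_points \<alpha> \<Longrightarrow> \<alpha> g x = x"
  by (simp add: fixed_points_def)

lemma fixed_points_add: "x \<in> fixed_points \<alpha> \<Longrightarrow> y \<in> fixed_points \<alpha> \<Longrightarrow> x + y \<in> fixed_points \<alpha>"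
  and fixed_points_scaleC: "x \<in> fixed_points \<alpha> \<Longrightarrow> c *\<^sub>C x \<in> fixed_points \<alpha>"
  and fixed_points_mult: "x \<in> fixed_points \<alpha> \<Longrightarrow> y \<in> fixed_points \<alpha> \<Longrightarrow> x * y \<in> fixed_points \<alpha>"
  and fixed_points_adj: "x \<in> fixed_points \<alpha> \<Longrightarrow> adj x \<in> fixed_points \<alpha>"
  by (auto simp: fixed_points_def action_add action_scaleC action_mult action_adj)

lemma fixed_centerD:
  assumes "z \<in> fixed_center \<alpha>"
  shows "z \<in> fixed_points \<alpha>" "A \<in> fixed_points \<alpha> \<Longrightarrow> A * z = z * A"
  using assms by (auto simp: fixed_center_def commutant_def)

lemma fixed_center_adj:
  assumes "z \<in> fixed_center \<alpha>" shows "adj z \<in> fixed_center \<alpha>"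
proof -
  have "A * adj z = adj z * A" if "A \<in> fixed_points \<alpha>" for A
    using fixed_centerD(2)[OF assms fixed_points_adj[OF that]] by (metis adj_adj adj_mult)
  then show ?thesis
    using fixed_points_adj[OF fixed_centerD(1)[OF assms]] by (auto simp: fixed_center_def commutant_def)
qed

end

text \<open>Orthonormality of the rows of \<open>u\<close> collapses the double sum to its diagonal.
  With adjoint frame vectors for \<open>d\<close> this gives invariance of the canonical
  endomorphism, with a conjugate frame for \<open>d\<close> the invariant vectors used
  later.\<close>

lemma unitary_sum:
  fixes a d :: "nat \<Rightarrow> 'f::unital_cstar_algebra"
  assumes u: "\<And>b c. b < n \<Longrightarrow> c < n \<Longrightarrow> (\<Sum>k<n. u b k * cnj (u c k)) = (if b = c then 1 else 0)"
  shows "(\<Sum>k<n. (\<Sum>b<n. u b k *\<^sub>C a b) * M * (\<Sum>c<n. cnj (u c k) *\<^sub>C d c)) = (\<Sum>b<n. a b * M * d b)"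
proof -
  have "(\<Sum>k<n. (\<Sum>b<n. u b k *\<^sub>C a b) * M * (\<Sum>c<n. cnj (u c k) *\<^sub>C d c))
      = (\<Sum>k<n. \<Sum>b<n. \<Sum>c<n. (u b k * cnj (u c k)) *\<^sub>C (a b * M * d c))"
    by (simp add: sum_distrib_right[of _ _ M] sum_product mult_scaleC_left mult_scaleC_right
        scaleC_scaleC mult.commute[of "cnj _"])
  also have "\<dots> = (\<Sum>b<n. \<Sum>k<n. \<Sum>c<n. (u b k * cnj (u c k)) *\<^sub>C (a b * M * d c))"
    by (rule sum.swap)
  also have "\<dots> = (\<Sum>b<n. \<Sum>c<n. \<Sum>k<n. (u b k * cnj (u c k)) *\<^sub>C (a b * M * d c))"
    by (intro sum.cong refl sum.swap)
  also have "\<dots> = (\<Sum>b<n. \<Sum>c<n. if c = b then a b * M * d b else 0)"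
    by (intro sum.cong refl) (auto simp: u simp flip: cvec.scale_sum_left)
  finally show ?thesis by simp
qed

section \<open>Frames and their canonical endomorphisms\<close>

text \<open>An orthonormal basis numbered by naturals, with the action in coordinates: column
  \<open>k\<close> of \<open>U g\<close> holds the coefficients of the image of
  \<open>\<Phi> k\<close>. That \<open>U\<close> is a continuous unitary representation is derived,
  not assumed.\<close>

locale hilbert_frame = algebra_action \<alpha>
  for \<alpha> :: "'g::topological_group_add \<Rightarrow> 'f::unital_cstar_algebra \<Rightarrow> 'f" +
  fixes n :: nat and \<Phi> :: "nat \<Rightarrow> 'f" and U :: "'g \<Rightarrow> nat \<Rightarrow> nat \<Rightarrow> complex"
  assumes orthonormal: "i < n \<Longrightarrow> j < n \<Longrightarrow> adj (\<Phi> i) * \<Phi> j = (if i = j then 1 else 0)"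
    and support: "(\<Sum>i<n. \<Phi> i * adj (\<Phi> i)) = 1"
    and transform: "k < n \<Longrightarrow> \<alpha> g (\<Phi> k) = (\<Sum>i<n. U g i k *\<^sub>C \<Phi> i)"
begin

text \<open>The canonical formula is used on the whole algebra, so that the intertwining rules hold
  without membership conditions.\<close>

definition endo :: "'f \<Rightarrow> 'f" where
  "endo A = (\<Sum>i<n. \<Phi> i * A * adj (\<Phi> i))"

definition frame_span :: "'f set" where
  "frame_span = cvec.span (\<Phi> ` {..<n})"

lemma n_pos: "n > 0"
  using support by (cases n) auto

lemma inj_frame: "inj_on \<Phi> {..<n}"
  by (rule inj_onI) (metis lessThan_iff orthonormal zero_neq_one)

lemma orthonormal_basis_frame: "orthonormal_basis (\<Phi> ` {..<n}) frame_span"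
  unfolding orthonormal_basis_def frame_span_def
  using inj_frame by (auto simp: orthonormal dest: inj_onD)

lemma frame_coeff:
  assumes "i < n" shows "adj (\<Phi> i) * (\<Sum>k<n. w k *\<^sub>C \<Phi> k) = w i *\<^sub>C 1"
proof -
  have "adj (\<Phi> i) * (\<Sum>k<n. w k *\<^sub>C \<Phi> k) = (\<Sum>k<n. if k = i then w i *\<^sub>C 1 else 0)"
    unfolding sum_distrib_left mult_scaleC_right
    by (rule sum.cong[OF refl]) (use assms in \<open>simp add: orthonormal\<close>)
  then show ?thesis using assms by simp
qed

lemma frame_sum_mem: "(\<Sum>k<n. w k *\<^sub>C \<Phi> k) \<in> frame_span"
  unfolding frame_span_def by (intro cvec.span_sum cvec.span_scale cvec.span_base) auto

lemma frame_sum_eqD: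
  assumes "(\<Sum>k<n. v k *\<^sub>C \<Phi> k) = (\<Sum>k<n. w k *\<^sub>C \<Phi> k)" "i < n"
  shows "v i = w i"
  using assms frame_coeff[of i v] frame_coeff[of i w] by simp

lemma coeff: "i < n \<Longrightarrow> k < n \<Longrightarrow> adj (\<Phi> i) * \<alpha> g (\<Phi> k) = U g i k *\<^sub>C 1"
  by (simp add: transform frame_coeff)

lemma transform_adj: "k < n \<Longrightarrow> adj (\<alpha> g (\<Phi> k)) = (\<Sum>i<n. cnj (U g i k) *\<^sub>C adj (\<Phi> i))"
  by (simp add: transform adj_sum adj_scaleC)

lemma coeff_adj: "i < n \<Longrightarrow> k < n \<Longrightarrow> adj (\<alpha> g (\<Phi> k)) * \<Phi> i = cnj (U g i k) *\<^sub>C 1"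
  using arg_cong[OF coeff, of i k adj g] by (simp add: adj_mult adj_adj adj_scaleC)

text \<open>The transformed basis again has support 1; this identity is inserted between
  \<open>adj (\<Phi> b)\<close> and \<open>\<Phi> c\<close>.\<close>

lemma unitary_row:
  assumes "b < n" "c < n"
  shows "(\<Sum>k<n. U g b k * cnj (U g c k)) = (if b = c then 1 else 0)"
proof -
  have "(\<Sum>k<n. U g b k * cnj (U g c k)) *\<^sub>C (1::'f) =
      (\<Sum>k<n. (adj (\<Phi> b) * \<alpha> g (\<Phi> k)) * (adj (\<alpha> g (\<Phi> k)) * \<Phi> c))"
    using assms by (simp add: coeff coeff_adj cvec.scale_sum_left mult_scaleC_left mult_scaleC_right scaleC_scaleC mult.commute)
  also have "\<dots> = adj (\<Phi> b) * \<alpha> g (\<Sum>k<n. \<Phi> k * adj (\<Phi> k)) * \<Phi> c"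
    by (simp add: action_sum action_mult action_adj sum_distrib_left sum_distrib_right mult.assoc)
  also have "\<dots> = (if b = c then 1 else 0) *\<^sub>C 1"
    using assms by (simp add: support action_one orthonormal)
  finally show ?thesis by (simp only: scaleC_one_eq_iff)
qed

text \<open>Here the original support relation is inserted between transformed basis vectors, which
  stay orthonormal.\<close>

lemma unitary_col:
  assumes "b < n" "c < n"
  shows "(\<Sum>k<n. U g k c * cnj (U g k b)) = (if b = c then 1 else 0)"
proof -
  have "(\<Sum>k<n. U g k c * cnj (U g k b)) *\<^sub>C (1::'f) =
      (\<Sum>k<n. (adj (\<alpha> g (\<Phi> b)) * \<Phi> k) * (adj (\<Phi> k) * \<alpha> g (\<Phi> c)))"
    using assms by (simp add: coeff coeff_adj cvec.scale_sum_left mult_scaleC_left mult_scaleC_right scaleC_scaleC mult.commute)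
  also have "\<dots> = adj (\<alpha> g (\<Phi> b)) * (\<Sum>k<n. \<Phi> k * adj (\<Phi> k)) * \<alpha> g (\<Phi> c)"
    by (simp add: sum_distrib_left sum_distrib_right mult.assoc)
  also have "\<dots> = \<alpha> g (adj (\<Phi> b) * \<Phi> c)"
    by (simp add: support action_mult action_adj)
  also have "\<dots> = (if b = c then 1 else 0) *\<^sub>C 1"
    using assms by (simp add: orthonormal action_one action_zero)
  finally show ?thesis by (simp only: scaleC_one_eq_iff)
qed

lemma coeff_plus:
  assumes "i < n" "k < n"
  shows "U (g + h) i k = (\<Sum>j<n. U g i j * U h j k)"
proof -
  have "U (g + h) i k *\<^sub>C (1::'f) = adj (\<Phi> i) * \<alpha> g (\<Sum>j<n. U h j k *\<^sub>C \<Phi> j)"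
    using assms by (simp add: action_plus transform flip: coeff)
  also have "\<dots> = (\<Sum>j<n. U h j k *\<^sub>C (adj (\<Phi> i) * \<alpha> g (\<Phi> j)))"
    by (simp add: action_sum action_scaleC sum_distrib_left mult_scaleC_right)
  also have "\<dots> = (\<Sum>j<n. U g i j * U h j k) *\<^sub>C 1"
    using assms by (simp add: coeff scaleC_scaleC cvec.scale_sum_left mult.commute)
  finally show ?thesis by simp
qed

text \<open>Multiples of 1 carry the distance of their scalars, so continuity is inherited from the
  norm-continuous orbit of \<open>\<Phi> k\<close>.\<close>

lemma coeff_continuous:
  assumes "i < n" "k < n"
  shows "continuous_on UNIV (\<lambda>g. U g i k)"
proof -
  have eq: "dist (U g i k) (U h i k) = dist (adj (\<Phi> i) * \<alpha> g (\<Phi> k)) (adj (\<Phi> i) * \<alpha> h (\<Phi> k))" for g h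
    using assms by (simp add: coeff dist_norm norm_scaleC flip: cvec.scale_left_diff_distrib)
  have "continuous_on UNIV (\<lambda>g. adj (\<Phi> i) * \<alpha> g (\<Phi> k))"
    by (intro continuous_intros action_continuous)
  then show ?thesis
    unfolding continuous_on tendsto_iff eq .
qed

text \<open>By orthonormality only the summand of \<open>\<Phi> i\<close> survives. This relation,
  with its adjoint, is how elements are moved past basis vectors throughout.\<close>

lemma endo_mult_frame: "i < n \<Longrightarrow> endo A * \<Phi> i = \<Phi> i * A"
proof -
  assume i: "i < n"
  have "endo A * \<Phi> i = (\<Sum>k<n. if k = i then \<Phi> i * A else 0)"
    unfolding endo_def sum_distrib_right
    by (rule sum.cong[OF refl]) (use i in \<open>simp add: orthonormal mult.assoc\<close>)
  then show ?thesis using i by simp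
qed

lemma endo_adj: "endo (adj A) = adj (endo A)"
  by (simp add: endo_def adj_sum adj_mult adj_adj mult.assoc)

lemma frame_mult_endo: "i < n \<Longrightarrow> adj (\<Phi> i) * endo A = A * adj (\<Phi> i)"
  using arg_cong[OF endo_mult_frame, of i adj "adj A"] by (simp add: adj_mult adj_adj endo_adj)

lemma endo_mult_span:
  assumes "x \<in> frame_span" shows "endo A * x = x * A"
proof -
  have "cvec.subspace {x. endo A * x = x * A}"
    by (rule cvec.subspaceI) (auto simp: distrib_left distrib_right mult_scaleC_left mult_scaleC_right)
  then have "cvec.span (\<Phi> ` {..<n}) \<subseteq> {x. endo A * x = x * A}"
    by (rule cvec.span_minimal[rotated]) (auto simp: endo_mult_frame)
  then show ?thesis using assms by (auto simp: frame_span_def)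
qed

text \<open>\<open>A\<close> is recovered as \<open>adj (\<Phi> 0) * endo A * \<Phi> 0\<close>, the
  index 0 being available since a nonzero support requires \<open>n > 0\<close>.\<close>

lemma endo_inj: "endo A = endo A' \<Longrightarrow> A = A'"
  using endo_mult_frame[OF n_pos, of A] endo_mult_frame[OF n_pos, of A'] orthonormal[OF n_pos n_pos]
  by (metis mult.assoc mult.left_neutral)

lemma endo_mult: "endo (A * A') = endo A * endo A'"
proof -
  have "endo A * endo A' = (\<Sum>i<n. (endo A * \<Phi> i) * A' * adj (\<Phi> i))"
    by (simp add: endo_def[of A'] sum_distrib_left mult.assoc)
  then show ?thesis by (simp add: endo_mult_frame endo_def[of "A * A'"] mult.assoc)
qed

lemma endo_add: "endo (A + A') = endo A + endo A'"
  by (simp add: endo_def distrib_left distrib_right sum.distrib)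

lemma endo_scaleC: "endo (c *\<^sub>C A) = c *\<^sub>C endo A"
  by (simp add: endo_def mult_scaleC_left mult_scaleC_right cvec.scale_sum_right)

text \<open>The basis and its transform differ by a unitary matrix, so both define the same
  endomorphism.\<close>

lemma endo_fixed:
  assumes "A \<in> fixed_points \<alpha>" shows "endo A \<in> fixed_points \<alpha>"
proof -
  have "\<alpha> g (endo A) = endo A" for g
  proof -
    have "\<alpha> g (endo A) = (\<Sum>k<n. \<alpha> g (\<Phi> k) * A * adj (\<alpha> g (\<Phi> k)))"
      using assms by (simp add: endo_def action_sum action_mult action_adj action_fixed)
    also have "\<dots> = (\<Sum>k<n. (\<Sum>b<n. U g b k *\<^sub>C \<Phi> b) * A * (\<Sum>c<n. cnj (U g c k) *\<^sub>C adj (\<Phi> c)))"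
      by (rule sum.cong[OF refl], simp only: lessThan_iff transform_adj, simp add: transform)
    also have "\<dots> = endo A" unfolding endo_def by (rule unitary_sum) (rule unitary_row)
    finally show ?thesis .
  qed
  then show ?thesis by (simp add: fixed_points_def)
qed

text \<open>The support \<open>E\<close> of an orthonormal basis of \<open>K\<close> is the
  projection onto \<open>K\<close>. It is invariant and commutes with the range of
  \<open>endo\<close>, so irreducibility writes it as \<open>endo z\<close>. A single basis vector
  of \<open>K\<close> forces \<open>z = 1\<close>, and then \<open>E = 1\<close>.\<close>

lemma irreducible_frame_span:
  assumes irr: "self_intertwiners \<alpha> endo \<subseteq> endo ` fixed_center \<alpha>"
    and K: "cvec.subspace K" "K \<subseteq> frame_span" and inv: "invariant_subset \<alpha> K"
  shows "K = {0} \<or> K = frame_span"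
proof -
  obtain C where C: "orthonormal_basis C K"
    using orthonormal_basis_subspace_exists[OF orthonormal_basis_frame K] .
  define E where "E = (\<Sum>\<Psi>\<in>C. \<Psi> * adj \<Psi>)"
  have EK: "E * x = x" if "x \<in> K" for x
    using orthonormal_basis_support_mult[OF C that] by (simp add: E_def)
  have CK: "C \<subseteq> K" using orthonormal_basis_subset[OF C] .
  have adjE: "adj E = E" by (simp add: E_def adj_sum adj_mult adj_adj)
  have aE: "\<alpha> g E = (\<Sum>\<Psi>\<in>C. \<alpha> g \<Psi> * adj (\<alpha> g \<Psi>))" for g
    by (simp add: E_def action_sum action_mult action_adj)
  \<comment> \<open>Invariance of \<open>K\<close> says that \<open>E\<close> dominates each of its
    transforms.\<close>
  have abs1: "E * \<alpha> g E = \<alpha> g E" for g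
    unfolding aE sum_distrib_left
  proof (rule sum.cong[OF refl])
    fix \<Psi> assume "\<Psi> \<in> C"
    then have "\<alpha> g \<Psi> \<in> K" using inv CK by (auto simp: invariant_subset_def)
    then show "E * (\<alpha> g \<Psi> * adj (\<alpha> g \<Psi>)) = \<alpha> g \<Psi> * adj (\<alpha> g \<Psi>)"
      by (simp add: EK flip: mult.assoc)
  qed
  \<comment> \<open>The reverse domination comes from \<open>abs1\<close> at \<open>- g\<close>,
    transported by \<open>\<alpha> g\<close>.\<close>
  have "\<alpha> g E = E" for g
  proof -
    have 1: "\<alpha> g E * E = \<alpha> g E"
      using arg_cong[OF abs1[of g], of adj] by (simp add: adj_mult adjE flip: action_adj)
    have "\<alpha> g (E * \<alpha> (- g) E) = \<alpha> g (\<alpha> (- g) E)" by (simp only: abs1)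
    then have "\<alpha> g E * E = E" by (simp add: action_mult action_inverse)
    with 1 show ?thesis by simp
  qed
  then have "E \<in> fixed_points \<alpha>" by (simp add: fixed_points_def)
  \<comment> \<open>Basis vectors of \<open>K\<close> also satisfy the intertwining relation, so
    both products equal the sum of \<open>\<Psi> * A * adj \<Psi>\<close> over
    \<open>C\<close>.\<close>
  moreover have "E * endo A = endo A * E" for A
  proof -
    have 1: "endo A * E = (\<Sum>\<Psi>\<in>C. \<Psi> * A * adj \<Psi>)" for A
      unfolding E_def sum_distrib_left
      by (rule sum.cong[OF refl]) (metis CK K(2) endo_mult_span mult.assoc subsetD)
    have "E * endo A = adj (endo (adj A) * E)" by (simp add: adj_mult adjE endo_adj adj_adj)
    also have "\<dots> = endo A * E" unfolding 1 by (simp add: adj_sum adj_mult adj_adj mult.assoc)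
    finally show ?thesis .
  qed
  ultimately have "E \<in> self_intertwiners \<alpha> endo" by (simp add: self_intertwiners_def)
  with irr obtain z where z: "E = endo z" by blast
  show ?thesis
  proof (cases "C = {}")
    case True
    then have "K = {0}" using C by (auto simp: orthonormal_basis_def)
    then show ?thesis ..
  next
    case False
    then obtain \<Psi> where \<Psi>: "\<Psi> \<in> C" by blast
    have "adj \<Psi> * \<Psi> = 1" using C \<Psi> by (simp add: orthonormal_basis_def)
    \<comment> \<open>Since \<open>E = endo z\<close> fixes \<open>\<Psi>\<close>, the intertwining
      relation moves \<open>z\<close> to the right of \<open>\<Psi>\<close>, which can then be
      cancelled.\<close>
    moreover have "\<Psi> = \<Psi> * z" using EK[of \<Psi>] endo_mult_span[of \<Psi> z] z \<Psi> CK K(2) by (metis subsetD)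
    ultimately have "z = 1" by (metis mult.assoc mult.left_neutral)
    have "frame_span \<subseteq> K"
    proof
      fix x assume x: "x \<in> frame_span"
      have "x = E * x" using endo_mult_span[OF x, of z] z \<open>z = 1\<close> by simp
      also have "\<dots> = (\<Sum>\<Psi>\<in>C. scalar_of (adj \<Psi> * x) *\<^sub>C \<Psi>)"
        unfolding E_def sum_distrib_right
      proof (rule sum.cong[OF refl])
        fix \<Psi> assume "\<Psi> \<in> C"
        then have "adj \<Psi> * x = scalar_of (adj \<Psi> * x) *\<^sub>C 1"
          using orthonormal_basis_scalar_product[OF orthonormal_basis_frame _ x] CK K(2) by blast
        then show "\<Psi> * adj \<Psi> * x = scalar_of (adj \<Psi> * x) *\<^sub>C \<Psi>"
          by (metis mult.assoc mult.right_neutral mult_scaleC_right)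
      qed
      also have "\<dots> \<in> K"
        by (intro cvec.subspace_sum cvec.subspace_scale K(1)) (use CK in auto)
      finally show "x \<in> K" .
    qed
    with K(2) show ?thesis by auto
  qed
qed

section \<open>The conjugate representation and its irreducibility\<close>

definition conj_rep :: "'g \<Rightarrow> complex mat" where
  "conj_rep g = mat n n (\<lambda>(i, k). cnj (U g i k))"

lemma conj_rep_carrier: "conj_rep g \<in> carrier_mat n n"
  by (simp add: conj_rep_def)

lemma mat_adjoint_conj_rep: "mat_adjoint (conj_rep g) = mat n n (\<lambda>(i, k). U g k i)"
  by (rule eq_matI) (auto simp: mat_adjoint_def conj_rep_def mat_of_rows_index)

lemma unitary_conj_rep: "unitary_rep n conj_rep"
  unfolding unitary_rep_def
proof (intro conjI allI impI)
  fix g h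
  show "conj_rep g * mat_adjoint (conj_rep g) = 1\<^sub>m n"
    unfolding mat_adjoint_conj_rep unfolding conj_rep_def
    by (rule eq_matI) (auto simp: scalar_prod_def unitary_row mult.commute atLeast0LessThan)
  show "mat_adjoint (conj_rep g) * conj_rep g = 1\<^sub>m n"
    unfolding mat_adjoint_conj_rep unfolding conj_rep_def
    by (rule eq_matI) (auto simp: scalar_prod_def unitary_col mult.commute atLeast0LessThan)
  show "conj_rep (g + h) = conj_rep g * conj_rep h"
    unfolding conj_rep_def
    by (rule eq_matI) (auto simp: scalar_prod_def coeff_plus atLeast0LessThan)
next
  fix i j assume "i < n" "j < n"
  then show "continuous_on UNIV (\<lambda>g. conj_rep g $$ (i, j))"
    by (simp add: conj_rep_def continuous_on_cnj coeff_continuous)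
qed (rule conj_rep_carrier)

lemma conj_rep_mult_vec:
  assumes "v \<in> carrier_vec n" "i < n"
  shows "(conj_rep g *\<^sub>v v) $ i = (\<Sum>k<n. cnj (U g i k) * v $ k)"
  using assms by (auto simp: conj_rep_def scalar_prod_def atLeast0LessThan)

text \<open>The antilinear map \<open>T\<close>, which conjugates coordinates, intertwines
  \<open>conj_rep\<close> with the action on \<open>frame_span\<close>. Being antilinear, it still
  maps subspaces to subspaces, so \<open>irreducible_frame_span\<close> applies to the image of
  \<open>W\<close>.\<close>

lemma irreducible_conj_rep:
  assumes irr: "self_intertwiners \<alpha> endo \<subseteq> endo ` fixed_center \<alpha>"
  shows "irreducible_unitary_rep n conj_rep"
  unfolding irreducible_unitary_rep_def
proof (intro conjI allI impI n_pos unitary_conj_rep, elim conjE)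
  fix W :: "complex vec set"
  assume W: "W \<subseteq> carrier_vec n" and W0: "0\<^sub>v n \<in> W" and Wadd: "\<forall>v\<in>W. \<forall>w\<in>W. v + w \<in> W"
    and Wsc: "\<forall>c. \<forall>v\<in>W. c \<cdot>\<^sub>v v \<in> W" and Winv: "\<forall>g. \<forall>v\<in>W. conj_rep g *\<^sub>v v \<in> W"
  have Wc: "v \<in> carrier_vec n" if "v \<in> W" for v using W that by blast
  define T where "T v = (\<Sum>k<n. cnj (v $ k) *\<^sub>C \<Phi> k)" for v :: "complex vec"
  have Tinj: "v = w" if "v \<in> carrier_vec n" "w \<in> carrier_vec n" "T v = T w" for v w
    using that(1,2) frame_sum_eqD[OF that(3)[unfolded T_def]] by (intro eq_vecI) auto
  have T0: "T (0\<^sub>v n) = 0" by (simp add: T_def)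
  have Tadd: "T (v + w) = T v + T w" if "v \<in> W" "w \<in> W" for v w
    using that[THEN Wc] by (simp add: T_def scaleC_add_left sum.distrib)
  have Tsc: "T (c \<cdot>\<^sub>v v) = cnj c *\<^sub>C T v" if "v \<in> W" for c v
    using that[THEN Wc] by (simp add: T_def cvec.scale_sum_right scaleC_scaleC)
  have Tinv: "\<alpha> g (T v) = T (conj_rep g *\<^sub>v v)" if "v \<in> W" for g v
  proof -
    have "\<alpha> g (T v) = (\<Sum>k<n. \<Sum>i<n. (cnj (v $ k) * U g i k) *\<^sub>C \<Phi> i)"
      by (simp add: T_def action_sum action_scaleC transform cvec.scale_sum_right scaleC_scaleC)
    also have "\<dots> = (\<Sum>i<n. \<Sum>k<n. (cnj (v $ k) * U g i k) *\<^sub>C \<Phi> i)"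
      by (rule sum.swap)
    also have "\<dots> = T (conj_rep g *\<^sub>v v)"
      unfolding T_def
      by (rule sum.cong[OF refl])
        (use that[THEN Wc] in \<open>simp add: conj_rep_mult_vec cvec.scale_sum_left mult.commute\<close>)
    finally show ?thesis .
  qed
  have sub: "cvec.subspace (T ` W)"
  proof (rule cvec.subspaceI)
    show "0 \<in> T ` W" using W0 T0 by force
    show "x + y \<in> T ` W" if "x \<in> T ` W" "y \<in> T ` W" for x y
      using that Wadd Tadd by (metis (no_types, lifting) image_iff)
    show "c *\<^sub>C x \<in> T ` W" if x: "x \<in> T ` W" for c x
    proof -
      obtain v where v: "v \<in> W" "x = T v" using x by blast
      then have "c *\<^sub>C x = T (cnj c \<cdot>\<^sub>v v)" by (simp add: Tsc)
      moreover have "cnj c \<cdot>\<^sub>v v \<in> W" using v(1) Wsc by simp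
      ultimately show ?thesis by simp
    qed
  qed
  have "T ` W \<subseteq> frame_span" by (auto simp: T_def frame_sum_mem)
  moreover have "invariant_subset \<alpha> (T ` W)"
    unfolding invariant_subset_def using Winv Tinv by blast
  ultimately have "T ` W = {0} \<or> T ` W = frame_span"
    by (rule irreducible_frame_span[OF irr sub])
  then show "W = {0\<^sub>v n} \<or> W = carrier_vec n"
  proof
    assume 1: "T ` W = {0}"
    have "W \<subseteq> {0\<^sub>v n}"
    proof
      fix v assume v: "v \<in> W"
      then have "T v \<in> T ` W" by (rule imageI)
      then have "T v = T (0\<^sub>v n)" by (simp add: 1 T0)
      then have "v = 0\<^sub>v n" using Tinj[OF Wc[OF v]] by simp
      then show "v \<in> {0\<^sub>v n}" by simp
    qed
    then show ?thesis using W0 by blast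
  next
    assume 2: "T ` W = frame_span"
    have "v \<in> W" if v: "v \<in> carrier_vec n" for v
    proof -
      have "T v \<in> T ` W" unfolding 2 by (simp add: T_def frame_sum_mem)
      then obtain w where "w \<in> W" "T v = T w" by blast
      then show ?thesis using Tinj[OF v Wc] by simp
    qed
    then have "W = carrier_vec n" by (intro equalityI W subsetI)
    then show ?thesis ..
  qed
qed

end

section \<open>Frames obtained from algebraic Hilbert spaces\<close>

text \<open>The images of the unit vectors under the intertwiner form the frame. They transform by
  the columns of \<open>\<pi> g\<close>, which is the convention of
  \<open>hilbert_frame\<close>.\<close>

lemma carries_class_frame:
  assumes \<alpha>: "cstar_action \<alpha>" and H: "algebraic_hilbert_space H" and car: "carries_class \<alpha> H n \<pi>"
    and \<pi>: "\<And>g. \<pi> g \<in> carrier_mat n n"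
  obtains \<Psi> where "hilbert_frame \<alpha> n \<Psi> (\<lambda>g i k. \<pi> g $$ (i, k))"
proof -
  obtain V where bij: "bij_betw V (carrier_vec n) H"
    and inner: "\<And>v w. v \<in> carrier_vec n \<Longrightarrow> w \<in> carrier_vec n \<Longrightarrow> adj (V v) * V w = (w \<bullet>c v) *\<^sub>C 1"
    and act: "\<And>g v. v \<in> carrier_vec n \<Longrightarrow> \<alpha> g (V v) = V (\<pi> g *\<^sub>v v)"
    using car unfolding carries_class_def by blast
  define \<Psi> where "\<Psi> i = V (unit_vec n i)" for i
  have subH: "cvec.subspace H" using H by (simp add: algebraic_hilbert_space_def)
  have VH: "V v \<in> H" if "v \<in> carrier_vec n" for v using bij that by (auto simp: bij_betw_def)
  have \<Psi>H: "\<Psi> i \<in> H" for i by (simp add: \<Psi>_def VH)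
  have expand: "V v = (\<Sum>i<n. v $ i *\<^sub>C \<Psi> i)" if v: "v \<in> carrier_vec n" for v
  proof -
    \<comment> \<open>The difference lies in \<open>H\<close>, so it is some \<open>V w\<close>; the
      scalar products then give \<open>adj y * y = 0\<close>.\<close>
    define y where "y = V v - (\<Sum>i<n. v $ i *\<^sub>C \<Psi> i)"
    have "y \<in> H" unfolding y_def
      by (intro cvec.subspace_diff cvec.subspace_sum cvec.subspace_scale subH VH v \<Psi>H)
    then obtain w where w: "w \<in> carrier_vec n" "y = V w" using bij by (auto simp: bij_betw_def)
    have "adj (V w) * (\<Sum>i<n. v $ i *\<^sub>C \<Psi> i) = (\<Sum>i<n. (v $ i * cnj (w $ i)) *\<^sub>C 1)"
      unfolding sum_distrib_left mult_scaleC_right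
      by (rule sum.cong[OF refl])
        (use w in \<open>simp add: \<Psi>_def inner scalar_prod_left_unit scaleC_scaleC\<close>)
    also have "\<dots> = (v \<bullet>c w) *\<^sub>C 1"
      using v w by (auto simp: scalar_prod_def atLeast0LessThan simp flip: cvec.scale_sum_left)
    also have "\<dots> = adj (V w) * V v" using v w by (simp add: inner)
    finally have "adj y * y = 0"
      unfolding w(2)[symmetric] by (subst (2) y_def) (simp add: right_diff_distrib)
    then have "y = 0" by simp
    then show ?thesis by (simp add: y_def)
  qed
  have orth: "adj (\<Psi> i) * \<Psi> j = (if i = j then 1 else 0)" if "i < n" "j < n" for i j
    using that by (auto simp: \<Psi>_def inner scalar_prod_left_unit)
  \<comment> \<open>\<open>?P\<close> acts as the identity on \<open>H\<close>, hence fixes the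
    support of a basis whose support is 1, which gives \<open>?P = 1\<close>.\<close>
  let ?P = "\<Sum>i<n. \<Psi> i * adj (\<Psi> i)"
  have P\<Psi>: "?P * \<Psi> j = \<Psi> j" if "j < n" for j
  proof -
    have "?P * \<Psi> j = (\<Sum>i<n. if i = j then \<Psi> j else 0)"
      unfolding sum_distrib_right
      by (rule sum.cong[OF refl]) (use that in \<open>simp add: orth mult.assoc\<close>)
    then show ?thesis using that by simp
  qed
  have PH: "?P * x = x" if x: "x \<in> H" for x
  proof -
    obtain v where v: "v \<in> carrier_vec n" "x = V v" using bij x by (auto simp: bij_betw_def)
    have "?P * (\<Sum>i<n. v $ i *\<^sub>C \<Psi> i) = (\<Sum>i<n. v $ i *\<^sub>C \<Psi> i)"
      by (subst sum_distrib_left, rule sum.cong[OF refl], simp only: mult_scaleC_right P\<Psi> lessThan_iff)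
    then show ?thesis using v expand by simp
  qed
  obtain C where C: "orthonormal_basis C H" "(\<Sum>\<Phi>\<in>C. \<Phi> * adj \<Phi>) = 1"
    using H unfolding algebraic_hilbert_space_def by blast
  have "?P * (\<Sum>\<Phi>\<in>C. \<Phi> * adj \<Phi>) = (\<Sum>\<Phi>\<in>C. \<Phi> * adj \<Phi>)"
    unfolding sum_distrib_left[of ?P]
    by (rule sum.cong[OF refl]) (metis PH orthonormal_basis_subset[OF C(1)] subsetD mult.assoc)
  then have supp: "?P = 1" using C by simp
  have "hilbert_frame \<alpha> n \<Psi> (\<lambda>g i k. \<pi> g $$ (i, k))"
  proof
    show "cstar_action \<alpha>" by (rule \<alpha>)
    show "\<alpha> g (\<Psi> k) = (\<Sum>i<n. \<pi> g $$ (i, k) *\<^sub>C \<Psi> i)" if "k < n" for g k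
    proof -
      have eq: "\<pi> g *\<^sub>v unit_vec n k = col (\<pi> g) k"
        using that \<pi>[of g] by (auto intro!: eq_vecI)
      have "\<alpha> g (\<Psi> k) = V (col (\<pi> g) k)" by (simp add: \<Psi>_def act eq)
      also have "\<dots> = (\<Sum>i<n. col (\<pi> g) k $ i *\<^sub>C \<Psi> i)"
        by (rule expand) (use \<pi>[of g] in auto)
      also have "\<dots> = (\<Sum>i<n. \<pi> g $$ (i, k) *\<^sub>C \<Psi> i)"
        by (rule sum.cong[OF refl]) (use \<pi>[of g] that in auto)
      finally show ?thesis .
    qed
  qed (use orth supp in auto)
  then show thesis using that by blast
qed

text \<open>The basis \<open>B\<close> is kept rather than chosen anew, so that an endomorphism
  given by a sum over \<open>B\<close> becomes \<open>endo\<close>. Invariance of \<open>H\<close>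
  lets the coefficients \<open>U\<close> be read off as scalar products.\<close>

lemma invariant_space_frame:
  assumes \<alpha>: "cstar_action \<alpha>" and H: "algebraic_hilbert_space H" and inv: "invariant_subset \<alpha> H"
    and B: "orthonormal_basis B H"
  obtains n \<Phi> U where "hilbert_frame \<alpha> n \<Phi> U" "bij_betw \<Phi> {..<n} B"
proof -
  have fin: "finite B" and o: "\<And>x y. x \<in> B \<Longrightarrow> y \<in> B \<Longrightarrow> adj x * y = (if x = y then 1 else 0)"
    using B by (auto simp: orthonormal_basis_def)
  obtain \<Phi> where bij: "bij_betw \<Phi> {..<card B} B"
    using ex_bij_betw_nat_finite[OF fin] by (auto simp: atLeast0LessThan)
  have mem: "\<Phi> i \<in> B" if "i < card B" for i using bij that by (auto simp: bij_betw_def)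
  have "hilbert_frame \<alpha> (card B) \<Phi> (\<lambda>g i k. scalar_of (adj (\<Phi> i) * \<alpha> g (\<Phi> k)))"
  proof
    show "cstar_action \<alpha>" by (rule \<alpha>)
    show "adj (\<Phi> i) * \<Phi> j = (if i = j then 1 else 0)" if "i < card B" "j < card B" for i j
      using that bij by (auto simp: o mem bij_betw_def dest: inj_onD)
    show "(\<Sum>i<card B. \<Phi> i * adj (\<Phi> i)) = 1"
      using orthonormal_basis_support[OF H B] by (simp add: sum.reindex_bij_betw[OF bij, of "\<lambda>x. x * adj x"])
    fix k g assume "k < card B"
    then have "\<Phi> k \<in> H" using mem orthonormal_basis_subset[OF B] by blast
    then have "\<alpha> g (\<Phi> k) \<in> H" using inv unfolding invariant_subset_def by blast
    from orthonormal_basis_expansion[OF B this]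
    show "\<alpha> g (\<Phi> k) = (\<Sum>i<card B. scalar_of (adj (\<Phi> i) * \<alpha> g (\<Phi> k)) *\<^sub>C \<Phi> i)"
      by (simp add: sum.reindex_bij_betw[OF bij, of "\<lambda>x. scalar_of (adj x * \<alpha> g (\<Phi> k)) *\<^sub>C x"])
  qed
  then show thesis using bij that by blast
qed

section \<open>Conjugate Hilbert spaces\<close>

locale conjugate_frames =
  \<Phi>: hilbert_frame \<alpha> n \<Phi> U + \<Psi>: hilbert_frame \<alpha> n \<Psi> "\<lambda>g i k. cnj (U g i k)"
  for \<alpha> :: "'g::topological_group_add \<Rightarrow> 'f::unital_cstar_algebra \<Rightarrow> 'f"
    and n \<Phi> \<Psi> U
begin

text \<open>This is the invariant vector in the tensor product of a representation with its
  conjugate. The middle factor \<open>M\<close> is arbitrary and is not transformed.\<close>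

lemma conjugate_sum_invariant:
  "(\<Sum>k<n. \<alpha> g (\<Phi> k) * M * \<alpha> g (\<Psi> k)) = (\<Sum>k<n. \<Phi> k * M * \<Psi> k)"
proof -
  have "(\<Sum>k<n. \<alpha> g (\<Phi> k) * M * \<alpha> g (\<Psi> k)) =
      (\<Sum>k<n. (\<Sum>b<n. U g b k *\<^sub>C \<Phi> b) * M * (\<Sum>c<n. cnj (U g c k) *\<^sub>C \<Psi> c))"
    by (simp add: \<Phi>.transform \<Psi>.transform)
  also have "\<dots> = (\<Sum>k<n. \<Phi> k * M * \<Psi> k)"
    by (rule unitary_sum) (rule \<Phi>.unitary_row)
  finally show ?thesis .
qed

lemma conjugate_sum_adj_invariant:
  "(\<Sum>k<n. adj (\<alpha> g (\<Psi> k)) * M * adj (\<alpha> g (\<Phi> k))) = (\<Sum>k<n. adj (\<Psi> k) * M * adj (\<Phi> k))"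
  using arg_cong[OF conjugate_sum_invariant[of g "adj M"], of adj]
  by (simp add: adj_sum adj_mult adj_adj mult.assoc)

text \<open>Conjugating twice gives \<open>U\<close> back; this provides the invariant sums with the
  two factors in the opposite order.\<close>

lemma conjugate_frames_swap: "conjugate_frames \<alpha> n \<Psi> \<Phi> (\<lambda>g i k. cnj (U g i k))"
  by (simp add: conjugate_frames_def \<Phi>.hilbert_frame_axioms \<Psi>.hilbert_frame_axioms)

text \<open>
  The matrix of \<open>z\<close> with respect to the basis \<open>\<Psi>\<close> has entries in the center by minimality.
  Transported to \<open>\<Phi>\<close> it is an invariant self-intertwiner \<open>Y\<close> of \<open>\<Phi>.endo\<close>, hence scalar.
\<close>

lemma center_mult_conjugate:
  assumes min: "minimal_system \<alpha>"
    and irr: "self_intertwiners \<alpha> \<Phi>.endo \<subseteq> \<Phi>.endo ` fixed_center \<alpha>"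
    and z: "z \<in> fixed_center \<alpha>"
  shows "\<exists>c\<in>fixed_center \<alpha>. \<forall>k<n. z * \<Psi> k = \<Psi> k * c"
proof -
  define X where "X i k = adj (\<Psi> i) * z * \<Psi> k" for i k
  \<comment> \<open>\<open>A\<close> passes each basis vector as \<open>\<Psi>.endo A\<close>, which
    is again a fixed point and so commutes with \<open>z\<close>.\<close>
  have X: "A * X i k = X i k * A" if A: "A \<in> fixed_points \<alpha>" and ik: "i < n" "k < n" for A i k
  proof -
    have "A * X i k = adj (\<Psi> i) * (\<Psi>.endo A * z) * \<Psi> k"
      unfolding X_def using \<Psi>.frame_mult_endo[OF ik(1), of A] by (simp flip: mult.assoc)
    also have "\<Psi>.endo A * z = z * \<Psi>.endo A"
      using \<Phi>.fixed_centerD(2)[OF z] \<Psi>.endo_fixed[OF A] by blast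
    also have "adj (\<Psi> i) * (z * \<Psi>.endo A) * \<Psi> k = X i k * A"
      unfolding X_def using \<Psi>.endo_mult_frame[OF ik(2), of A] by (simp add: mult.assoc)
    finally show ?thesis .
  qed
  have XZ: "X i k \<in> fixed_center \<alpha>" if "i < n" "k < n" for i k
    using X[OF _ that] min by (auto simp: minimal_system_def commutant_def)
  \<comment> \<open>The indices are transposed: \<open>X i k\<close> stands between
    \<open>\<Phi> k\<close> and \<open>adj (\<Phi> i)\<close>, because the two frames transform by
    conjugate matrices.\<close>
  define Y where "Y = (\<Sum>k<n. \<Sum>i<n. \<Phi> k * X i k * adj (\<Phi> i))"
  \<comment> \<open>The double sum is treated one index at a time: over \<open>k\<close> with
    \<open>adj (\<alpha> g (\<Psi> i)) * z\<close> in the middle, then over \<open>i\<close> with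
    \<open>z * \<Psi> k\<close> in the middle.\<close>
  have "\<alpha> g Y = Y" for g
  proof -
    have "\<alpha> g Y = (\<Sum>k<n. \<Sum>i<n. \<alpha> g (\<Phi> k) * (adj (\<alpha> g (\<Psi> i)) * z) * \<alpha> g (\<Psi> k) * adj (\<alpha> g (\<Phi> i)))"
      using \<Phi>.action_fixed[OF \<Phi>.fixed_centerD(1)[OF z]]
      by (simp add: Y_def X_def \<Phi>.action_sum \<Phi>.action_mult \<Phi>.action_adj mult.assoc)
    also have "\<dots> = (\<Sum>i<n. \<Sum>k<n. \<alpha> g (\<Phi> k) * (adj (\<alpha> g (\<Psi> i)) * z) * \<alpha> g (\<Psi> k) * adj (\<alpha> g (\<Phi> i)))"
      by (rule sum.swap)
    also have "\<dots> = (\<Sum>i<n. (\<Sum>k<n. \<Phi> k * (adj (\<alpha> g (\<Psi> i)) * z) * \<Psi> k) * adj (\<alpha> g (\<Phi> i)))"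
      by (simp add: conjugate_sum_invariant flip: sum_distrib_right)
    also have "\<dots> = (\<Sum>i<n. \<Sum>k<n. \<Phi> k * (adj (\<alpha> g (\<Psi> i)) * (z * \<Psi> k) * adj (\<alpha> g (\<Phi> i))))"
      by (simp add: sum_distrib_right mult.assoc)
    also have "\<dots> = (\<Sum>k<n. \<Sum>i<n. \<Phi> k * (adj (\<alpha> g (\<Psi> i)) * (z * \<Psi> k) * adj (\<alpha> g (\<Phi> i))))"
      by (rule sum.swap)
    also have "\<dots> = (\<Sum>k<n. \<Phi> k * (\<Sum>i<n. adj (\<Psi> i) * (z * \<Psi> k) * adj (\<Phi> i)))"
      by (simp only: conjugate_sum_adj_invariant flip: sum_distrib_left)
    also have "\<dots> = Y"
      by (simp add: Y_def X_def mult.assoc sum_distrib_left)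
    finally show ?thesis .
  qed
  then have "Y \<in> fixed_points \<alpha>" by (simp add: fixed_points_def)
  moreover have "Y * \<Phi>.endo A = \<Phi>.endo A * Y" if A: "A \<in> fixed_points \<alpha>" for A
  proof -
    have "Y * \<Phi>.endo A = (\<Sum>k<n. \<Sum>i<n. \<Phi> k * (X i k * A) * adj (\<Phi> i))"
      unfolding Y_def sum_distrib_right
      by (intro sum.cong refl) (simp add: \<Phi>.frame_mult_endo mult.assoc)
    also have "\<dots> = (\<Sum>k<n. \<Sum>i<n. \<Phi> k * (A * X i k) * adj (\<Phi> i))"
      by (intro sum.cong refl) (simp add: X[OF A])
    also have "\<dots> = \<Phi>.endo A * Y"
      unfolding Y_def sum_distrib_left
      by (intro sum.cong refl) (simp add: \<Phi>.endo_mult_frame flip: mult.assoc)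
    finally show ?thesis .
  qed
  ultimately have "Y \<in> self_intertwiners \<alpha> \<Phi>.endo" by (simp add: self_intertwiners_def)
  with irr obtain c where c: "c \<in> fixed_center \<alpha>" "Y = \<Phi>.endo c" by blast
  \<comment> \<open>Computing \<open>adj (\<Phi> k) * (Y * \<Phi> i)\<close> once from the
    definition of \<open>Y\<close> and once from \<open>Y = \<Phi>.endo c\<close> compares the
    entries.\<close>
  have Xc: "X i k = (if i = k then c else 0)" if ik: "i < n" "k < n" for i k
  proof -
    have "Y * \<Phi> i = (\<Sum>k<n. \<Sum>j<n. if j = i then \<Phi> k * X i k else 0)"
      unfolding Y_def sum_distrib_right
      by (intro sum.cong refl) (use ik in \<open>simp add: \<Phi>.orthonormal mult.assoc\<close>)
    then have "Y * \<Phi> i = (\<Sum>k<n. \<Phi> k * X i k)" using ik by simp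
    then have "adj (\<Phi> k) * (Y * \<Phi> i) = (\<Sum>l<n. if l = k then X i k else 0)"
      unfolding sum_distrib_left
      by (simp only: sum_distrib_left)
        (rule sum.cong[OF refl], use ik in \<open>simp add: \<Phi>.orthonormal flip: mult.assoc\<close>)
    then have "adj (\<Phi> k) * (Y * \<Phi> i) = X i k" using ik by simp
    moreover have "adj (\<Phi> k) * (Y * \<Phi> i) = (if i = k then c else 0)"
      using ik by (simp add: c(2) \<Phi>.endo_mult_frame \<Phi>.orthonormal flip: mult.assoc)
    ultimately show ?thesis by simp
  qed
  have "z * \<Psi> k = \<Psi> k * c" if k: "k < n" for k
  proof -
    have "z * \<Psi> k = (\<Sum>i<n. \<Psi> i * adj (\<Psi> i)) * (z * \<Psi> k)" by (simp add: \<Psi>.support)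
    also have "\<dots> = (\<Sum>i<n. \<Psi> i * X i k)"
      by (simp add: X_def sum_distrib_right mult.assoc)
    also have "\<dots> = (\<Sum>i<n. if i = k then \<Psi> k * c else 0)"
      by (rule sum.cong[OF refl]) (use k in \<open>simp add: Xc\<close>)
    finally show ?thesis using k by simp
  qed
  with c(1) show ?thesis by blast
qed

text \<open>
  The invariant element \<open>R\<close> recovers \<open>\<Phi> k\<close> as \<open>adj (\<Psi> k) * R\<close>, so that moving \<open>z\<close> past
  \<open>\<Phi> k\<close> from the right amounts to moving it past \<open>\<Psi> k\<close> from the left.
\<close>

lemma endo_center:
  assumes min: "minimal_system \<alpha>"
    and irr: "self_intertwiners \<alpha> \<Phi>.endo \<subseteq> \<Phi>.endo ` fixed_center \<alpha>"
    and z: "z \<in> fixed_center \<alpha>"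
  shows "\<Phi>.endo z \<in> fixed_center \<alpha>"
proof -
  \<comment> \<open>Starting from \<open>adj z\<close> makes the adjoint of the relation one about
    \<open>adj (\<Psi> k) * z\<close>, the form needed for
    \<open>\<Phi> k = adj (\<Psi> k) * R\<close>.\<close>
  obtain c where c: "c \<in> fixed_center \<alpha>" "\<And>k. k < n \<Longrightarrow> adj z * \<Psi> k = \<Psi> k * c"
    using center_mult_conjugate[OF min irr \<Phi>.fixed_center_adj[OF z]] by blast
  have cz: "adj (\<Psi> k) * z = adj c * adj (\<Psi> k)" if "k < n" for k
    using arg_cong[OF c(2)[OF that], of adj] by (simp add: adj_mult adj_adj)
  define R where "R = (\<Sum>k<n. \<Psi> k * \<Phi> k)"
  interpret swap: conjugate_frames \<alpha> n \<Psi> \<Phi> "\<lambda>g i k. cnj (U g i k)"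
    by (rule conjugate_frames_swap)
  have "\<alpha> g R = R" for g
    using swap.conjugate_sum_invariant[of g 1]
    by (simp add: R_def \<Phi>.action_sum \<Phi>.action_mult)
  then have R: "R \<in> fixed_points \<alpha>" by (simp add: fixed_points_def)
  have \<Phi>R: "\<Phi> k = adj (\<Psi> k) * R" if k: "k < n" for k
  proof -
    have "adj (\<Psi> k) * R = (\<Sum>i<n. if i = k then \<Phi> k else 0)"
      unfolding R_def sum_distrib_left
      by (rule sum.cong[OF refl]) (use k in \<open>simp add: \<Psi>.orthonormal flip: mult.assoc\<close>)
    then show ?thesis using k by simp
  qed
  have "\<Phi> k * z = adj c * \<Phi> k" if k: "k < n" for k
  proof -
    have "\<Phi> k * z = adj (\<Psi> k) * (R * z)" by (subst \<Phi>R[OF k]) (simp add: mult.assoc)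
    also have "R * z = z * R" using \<Phi>.fixed_centerD(2)[OF z R] .
    also have "adj (\<Psi> k) * (z * R) = adj c * (adj (\<Psi> k) * R)"
      by (metis cz[OF k] mult.assoc)
    finally show ?thesis using \<Phi>R[OF k] by simp
  qed
  \<comment> \<open>The factor \<open>adj c\<close> does not depend on \<open>k\<close>, so it
    leaves the sum and the support relation remains.\<close>
  then have "\<Phi>.endo z = adj c * (\<Sum>k<n. \<Phi> k * adj (\<Phi> k))"
    by (simp add: \<Phi>.endo_def sum_distrib_left mult.assoc)
  then show ?thesis using \<Phi>.support \<Phi>.fixed_center_adj[OF c(1)] by simp
qed

end

section \<open>Restriction of an irreducible canonical endomorphism to the center\<close>

theorem proposition5p1:
  fixes \<alpha> :: "'g::{topological_group_add, t2_space} \<Rightarrow> 'f::unital_cstar_algebra \<Rightarrow> 'f"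
    and \<rho> :: "'f \<Rightarrow> 'f"
  assumes "hilbert_cstar_system \<alpha>"
    and "minimal_system \<alpha>"
    and "\<exists>g h :: 'g. g + h \<noteq> h + g"
    and "property_B (fixed_points \<alpha>)"
    and "canonical_endomorphism \<alpha> \<rho>"
    and "irreducible_endomorphism \<alpha> \<rho>"
  shows "\<rho> ` fixed_center \<alpha> = fixed_center \<alpha> \<and> star_automorphism_on (fixed_center \<alpha>) \<rho>"
proof -
  have act: "cstar_action \<alpha>" using assms(1) by (simp add: hilbert_cstar_system_def)
  obtain H B where H: "algebraic_hilbert_space H" "invariant_subset \<alpha> H" "orthonormal_basis B H"
    and \<rho>B: "\<And>A. A \<in> fixed_points \<alpha> \<Longrightarrow> \<rho> A = (\<Sum>\<Phi>\<in>B. \<Phi> * A * adj \<Phi>)"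
    using assms(5) unfolding canonical_endomorphism_def by blast
  obtain n \<Phi> U where fr: "hilbert_frame \<alpha> n \<Phi> U" and bij: "bij_betw \<Phi> {..<n} B"
    using invariant_space_frame[OF act H] .
  interpret \<Phi>: hilbert_frame \<alpha> n \<Phi> U by (rule fr)
  let ?A = "fixed_points \<alpha>" and ?Z = "fixed_center \<alpha>"
  \<comment> \<open>\<open>\<rho>\<close> is prescribed only on the fixed point algebra; agreement
    with \<open>\<Phi>.endo\<close> there suffices to transfer irreducibility.\<close>
  have \<rho>: "\<rho> A = \<Phi>.endo A" if "A \<in> ?A" for A
    using \<rho>B[OF that] by (simp add: \<Phi>.endo_def sum.reindex_bij_betw[OF bij, of "\<lambda>x. x * A * adj x"])
  have ZA: "z \<in> ?A" if "z \<in> ?Z" for z using that by (rule \<Phi>.fixed_centerD(1))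
  have \<rho>Z: "\<rho> ` ?Z = \<Phi>.endo ` ?Z" using \<rho> ZA by (intro image_cong) auto
  have self: "self_intertwiners \<alpha> \<Phi>.endo = \<Phi>.endo ` ?Z"
    using assms(6) \<rho> \<rho>Z by (simp add: irreducible_endomorphism_def self_intertwiners_def cong: conj_cong)
  have "irreducible_unitary_rep n \<Phi>.conj_rep"
    by (rule \<Phi>.irreducible_conj_rep) (simp add: self)
  then obtain H' where H': "algebraic_hilbert_space H'" "carries_class \<alpha> H' n \<Phi>.conj_rep"
    using assms(1) unfolding hilbert_cstar_system_def by blast
  obtain \<Psi> where \<Psi>: "hilbert_frame \<alpha> n \<Psi> (\<lambda>g i k. \<Phi>.conj_rep g $$ (i, k))"
    using carries_class_frame[OF act H' \<Phi>.conj_rep_carrier] .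
  \<comment> \<open>The matrix entries of \<open>conj_rep\<close> are the numbers
    \<open>cnj (U g i k)\<close> only for indices below \<open>n\<close>, the range to which the
    frame conditions refer.\<close>
  interpret conjugate_frames \<alpha> n \<Phi> \<Psi> U
  proof -
    interpret \<Psi>: hilbert_frame \<alpha> n \<Psi> "\<lambda>g i k. \<Phi>.conj_rep g $$ (i, k)" by (rule \<Psi>)
    have "hilbert_frame \<alpha> n \<Psi> (\<lambda>g i k. cnj (U g i k))"
      by unfold_locales
        (auto simp: \<Psi>.orthonormal \<Psi>.support \<Psi>.transform \<Phi>.conj_rep_def)
    with fr show "conjugate_frames \<alpha> n \<Phi> \<Psi> U" by (simp add: conjugate_frames_def)
  qed
  have "\<Phi>.endo ` ?Z \<subseteq> ?Z"
    by (rule image_subsetI) (rule endo_center[OF assms(2) equalityD1[OF self]])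
  moreover have "?Z \<subseteq> \<Phi>.endo ` ?Z"
  proof
    fix z assume z: "z \<in> ?Z"
    \<comment> \<open>\<open>\<Phi>.endo\<close> preserves the fixed point algebra, with which
      central elements commute.\<close>
    have "z * \<Phi>.endo A = \<Phi>.endo A * z" if "A \<in> ?A" for A
      using \<Phi>.fixed_centerD(2)[OF z \<Phi>.endo_fixed[OF that]] by (rule sym)
    then show "z \<in> \<Phi>.endo ` ?Z"
      unfolding self[symmetric] self_intertwiners_def using ZA[OF z] by simp
  qed
  ultimately have img: "\<rho> ` ?Z = ?Z" unfolding \<rho>Z by (rule equalityI)
  have "inj_on \<rho> ?Z" by (rule inj_onI, rule \<Phi>.endo_inj) (simp add: ZA flip: \<rho>)
  then have "bij_betw \<rho> ?Z ?Z" using img by (simp add: bij_betw_def)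
  then have "star_automorphism_on ?Z \<rho>"
    unfolding star_automorphism_on_def
    by (intro conjI ballI allI)
      (simp_all add: \<rho> ZA \<Phi>.fixed_points_add \<Phi>.fixed_points_scaleC \<Phi>.fixed_points_mult
        \<Phi>.fixed_points_adj \<Phi>.endo_add \<Phi>.endo_scaleC \<Phi>.endo_mult \<Phi>.endo_adj)
  with img show ?thesis ..
qed

end
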